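(* Let $\rho$ be a non-negative integer, $\lambda>0$, and let $\pi^*$ be an unknown permutation of $[n]$. For a permutation $\pi$ of $[n]$ let $X_\pi\in\mathbb{R}^{n\times n}$ be the matrix with entries $(X_\pi)_{ij}=\lambda\mathbf{1}\{|\pi(i)-\pi(j)|\leq\rho\}$, and let $X=X_{\pi^*}$. Observe $Y=X+E$, where $E\in\mathbb{R}^{n\times n}$ has i.i.d. $\mathcal{N}(0,1)$ entries, and let $\hat\pi\in\arg\min_{\pi}\|Y-X_\pi\|_F^2$, the minimum being over all permutations $\pi$ of $[n]$, be the least-squares estimator. Then $$\frac{1}{n^2}\,\mathbb{E}\left[\|X_{\hat\pi}-X\|_F^2\right]\leq\frac{8\log(n)}{n}.$$ As a consequence, $X_{\hat\pi}$ achieves weak reconstruction as long as $\lambda$ is large compared to $\log(n)/\sqrt{\rho}$.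
   Context: $\|\cdot\|_F$ is the Frobenius norm. $X_0\in\mathbb{R}^{n\times n}$ is the best constant estimator, that is, $X_0=\mathbb{E}[X]$ when $\pi^*$ is sampled uniformly at random among all permutations of $[n]$: its diagonal entries equal $\lambda$ and its off-diagonal entries equal $\lambda\varphi$, where $\varphi=\frac{2\rho}{n-1}\left(1-\frac{\rho+1}{2n}\right)$ is the probability that $|\pi^*(i)-\pi^*(j)|\leq\rho$ for given $i\neq j$ under this uniform sampling. An estimator $\hat X$ is said to achieve weak reconstruction when $\frac{1}{n^2}\mathbb{E}[\|\hat X-X\|_F^2]$ is small compared to the risk $\frac{1}{n^2}\|X-X_0\|_F^2$ of this best constant estimator.
   Formalization: In the weak reconstruction consequence, ρ ≥ 1 and ρ ≤ (1−δ)n are assumed for an arbitrary δ > 0, with the constant depending on δ and the target ratio (and on the type of the sample space); for ρ = n−2 the unrestricted claim fails. *)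

theory Defs
  imports "HOL-Probability.Probability"
begin

text \<open>
  Since the constant in the weak reconstruction claim has to be uniform in the dimension,
  \<open>n \<times> n\<close> matrices are functions \<open>nat \<Rightarrow> nat \<Rightarrow> real\<close>, of which only the entries with
  indices in \<open>[n] = {1..n}\<close> are ever used.
\<close>

definition frobenius_norm :: "nat \<Rightarrow> (nat \<Rightarrow> nat \<Rightarrow> real) \<Rightarrow> real" where
  "frobenius_norm n A = sqrt (\<Sum>i\<in>{1..n}. \<Sum>j\<in>{1..n}. (A i j)\<^sup>2)"

definition signal :: "nat \<Rightarrow> real \<Rightarrow> (nat \<Rightarrow> nat) \<Rightarrow> nat \<Rightarrow> nat \<Rightarrow> real" where
  "signal \<rho> lam \<pi> i j = lam * of_bool (\<bar>int (\<pi> i) - int (\<pi> j)\<bar> \<le> int \<rho>)"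

text \<open>The best constant estimator: the mean of the signal under a uniformly random permutation.\<close>

definition best_constant :: "nat \<Rightarrow> nat \<Rightarrow> real \<Rightarrow> nat \<Rightarrow> nat \<Rightarrow> real" where
  "best_constant n \<rho> lam i j =
     measure_pmf.expectation (pmf_of_set {\<pi>. \<pi> permutes {1..n}}) (\<lambda>\<pi>. signal \<rho> lam \<pi> i j)"

text \<open>
  Any measurable selection \<open>\<pi>h\<close> from the set of minimisers is allowed, not
  necessarily one that depends on the outcome through the observation \<open>Y\<close> only.
\<close>

locale least_squares_model = prob_space M
  for M :: "'a measure" +
  fixes n \<rho> :: nat
    and lam :: real
    and \<pi>s :: "nat \<Rightarrow> nat"
    and E Y :: "'a \<Rightarrow> nat \<Rightarrow> nat \<Rightarrow> real"
    and \<pi>h :: "'a \<Rightarrow> nat \<Rightarrow> nat"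
  assumes n_pos: "1 \<le> n"
    and lam_pos: "0 < lam"
    and truth_permutes: "\<pi>s permutes {1..n}"
    and noise_indep: "indep_vars (\<lambda>_. borel) (\<lambda>(i, j) \<omega>. E \<omega> i j) ({1..n} \<times> {1..n})"
    and noise_std_normal:
      "\<And>i j. i \<in> {1..n} \<Longrightarrow> j \<in> {1..n} \<Longrightarrow>
         distributed M lborel (\<lambda>\<omega>. E \<omega> i j) std_normal_density"
    and observation:
      "\<And>\<omega> i j. \<omega> \<in> space M \<Longrightarrow> i \<in> {1..n} \<Longrightarrow> j \<in> {1..n} \<Longrightarrow>
         Y \<omega> i j = signal \<rho> lam \<pi>s i j + E \<omega> i j"
    and estimator_measurable: "\<pi>h \<in> M \<rightarrow>\<^sub>M count_space {\<pi>. \<pi> permutes {1..n}}"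
    and estimator_arg_min:
      "\<And>\<omega>. \<omega> \<in> space M \<Longrightarrow>
         is_arg_min (\<lambda>\<pi>. (frobenius_norm n (\<lambda>i j. Y \<omega> i j - signal \<rho> lam \<pi> i j))\<^sup>2)
           (\<lambda>\<pi>. \<pi> permutes {1..n}) (\<pi>h \<omega>)"

end

theory Submission imports Defs begin

text \<open>
  Let \<open>D\<close> be the difference between the fitted and the true signal. Optimality of the fit gives
  \<open>\<parallel>D\<parallel>\<^sup>2 \<le> 2 \<langle>E, D\<rangle>\<close>, that is, \<open>\<parallel>D\<parallel>\<^sup>2 / 8 \<le> \<langle>E, D\<rangle> / 2 - \<parallel>D\<parallel>\<^sup>2 / 8\<close>. For a fixed permutation the
  exponential of the right-hand side has mean one, so summing over all permutations gives
  \<open>\<bbbE> exp (\<parallel>D\<parallel>\<^sup>2 / 8) \<le> n!\<close>, and Jensen's inequality yields \<open>\<bbbE> \<parallel>D\<parallel>\<^sup>2 \<le> 8 ln n! \<le> 8 n ln n\<close>.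

  For weak reconstruction, the best constant estimator is constant off the diagonal, so its squared
  error is at least \<open>lam\<^sup>2 a b / (a + b)\<close>, where \<open>a\<close> and \<open>b\<close> count the off-diagonal entries of the
  signal that are nonzero and zero. Here \<open>a \<ge> n \<rho>\<close> and \<open>8 b \<ge> (n - \<rho>)\<^sup>2\<close> unless \<open>\<rho> \<ge> n - 1\<close>, when
  all the signals coincide.
\<close>

section \<open>Exponential moments of Gaussian noise and of random selections\<close>

text \<open>Completing the square. The exponential tilt of the standard normal density is again a
  probability density, so the tilting factor has mean one.\<close>

lemma normal_density_shift:
  "normal_density c 1 x = std_normal_density x * exp (c * x - c\<^sup>2 / 2)"
  unfolding normal_density_def
  by (simp add: exp_add[symmetric] field_simps power2_eq_square)

context prob_space
begin

lemma std_normal_exponential_moment: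
  assumes "distributed M lborel X std_normal_density"
  shows "integrable M (\<lambda>\<omega>. exp (c * X \<omega> - c\<^sup>2 / 2))"
    and "expectation (\<lambda>\<omega>. exp (c * X \<omega> - c\<^sup>2 / 2)) = 1"
proof -
  have meas: "(\<lambda>x::real. exp (c * x - c\<^sup>2 / 2)) \<in> borel_measurable lborel"
    by measurable
  show "integrable M (\<lambda>\<omega>. exp (c * X \<omega> - c\<^sup>2 / 2))"
    using distributed_integrable[OF assms meas] integrable_normal_density[of 1 c]
    by (simp add: normal_density_shift[symmetric])
  show "expectation (\<lambda>\<omega>. exp (c * X \<omega> - c\<^sup>2 / 2)) = 1"
    using distributed_integral[OF assms meas] integral_normal_density[of 1 c]
    by (simp add: normal_density_shift[symmetric])
qed

text \<open>Independence makes the mean of the product of tilts the product of their means. With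
  \<open>c\<close> a multiple of the signal difference, this is the moment of
  \<open>exp (W \<pi> \<omega>)\<close> for one fixed permutation.\<close>

lemma indep_std_normal_exponential_moment:
  fixes X :: "'i \<Rightarrow> 'a \<Rightarrow> real"
  assumes "finite I"
    and indep: "indep_vars (\<lambda>_. borel) X I"
    and normal: "\<And>i. i \<in> I \<Longrightarrow> distributed M lborel (X i) std_normal_density"
  shows "integrable M (\<lambda>\<omega>. exp (\<Sum>i\<in>I. c i * X i \<omega> - (c i)\<^sup>2 / 2))"
    and "expectation (\<lambda>\<omega>. exp (\<Sum>i\<in>I. c i * X i \<omega> - (c i)\<^sup>2 / 2)) = 1"
proof -
  have indep': "indep_vars (\<lambda>_. borel) (\<lambda>i \<omega>. exp (c i * X i \<omega> - (c i)\<^sup>2 / 2)) I"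
    by (rule indep_vars_compose2[OF indep]) measurable
  note moment = std_normal_exponential_moment[OF normal]
  show "integrable M (\<lambda>\<omega>. exp (\<Sum>i\<in>I. c i * X i \<omega> - (c i)\<^sup>2 / 2))"
    using indep_vars_integrable[OF \<open>finite I\<close> indep' moment(1)] \<open>finite I\<close>
    by (simp add: exp_sum)
  show "expectation (\<lambda>\<omega>. exp (\<Sum>i\<in>I. c i * X i \<omega> - (c i)\<^sup>2 / 2)) = 1"
    using indep_vars_lebesgue_integral[OF \<open>finite I\<close> indep' moment(1)] \<open>finite I\<close>
    by (simp add: exp_sum moment(2))
qed

text \<open>The selection \<open>Z\<close> may depend on every \<open>W b\<close>, so the selected
  exponential is bounded by the sum of all of them, whose mean is \<open>card F\<close>.\<close>

lemma expectation_selection_le_ln_card: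
  fixes g :: "'b \<Rightarrow> real" and W :: "'b \<Rightarrow> 'a \<Rightarrow> real"
  assumes "finite F" "F \<noteq> {}"
    and Z: "Z \<in> M \<rightarrow>\<^sub>M count_space F"
    and int: "\<And>b. b \<in> F \<Longrightarrow> integrable M (\<lambda>\<omega>. exp (W b \<omega>))"
    and one: "\<And>b. b \<in> F \<Longrightarrow> expectation (\<lambda>\<omega>. exp (W b \<omega>)) = 1"
    and le: "\<And>\<omega>. \<omega> \<in> space M \<Longrightarrow> g (Z \<omega>) \<le> W (Z \<omega>) \<omega>"
  shows "expectation (\<lambda>\<omega>. g (Z \<omega>)) \<le> ln (card F)"
proof -
  define N where "N = real (card F)"
  have "N > 0"
    using assms(1,2) by (auto simp: N_def card_gt_0_iff)
  have ZF: "Z \<omega> \<in> F" if "\<omega> \<in> space M" for \<omega>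
    using measurable_space[OF Z that] by simp
  have "(\<lambda>\<omega>. g (Z \<omega>)) \<in> borel_measurable M"
    using Z by (rule measurable_compose) simp
  \<comment> \<open>\<open>Z\<close> takes finitely many values, so \<open>g (Z \<omega>)\<close> is
    bounded.\<close>
  then have int_g: "integrable M (\<lambda>\<omega>. g (Z \<omega>))"
    by (rule integrable_const_bound[rotated, where B = "\<Sum>b\<in>F. \<bar>g b\<bar>"])
      (auto intro!: AE_I2 member_le_sum[where f = "\<lambda>b. \<bar>g b\<bar>"] ZF \<open>finite F\<close>)
  have "expectation (\<lambda>\<omega>. g (Z \<omega>)) \<le> expectation (\<lambda>\<omega>. (\<Sum>b\<in>F. exp (W b \<omega>)) / N - 1 + ln N)"
  proof (rule integral_mono[OF int_g])
    show "integrable M (\<lambda>\<omega>. (\<Sum>b\<in>F. exp (W b \<omega>)) / N - 1 + ln N)"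
      using int by auto
    fix \<omega> assume \<omega>: "\<omega> \<in> space M"
    \<comment> \<open>Jensen's inequality through a tangent line: \<open>1 + x \<le> exp x\<close>
      at \<open>x = g (Z \<omega>) - ln N\<close> leads to a bound that is linear in the
      exponentials.\<close>
    have "1 + (g (Z \<omega>) - ln N) \<le> exp (g (Z \<omega>) - ln N)"
      by (rule exp_ge_add_one_self)
    also have "\<dots> = exp (g (Z \<omega>)) / N"
      using \<open>N > 0\<close> by (simp add: exp_diff)
    also have "\<dots> \<le> (\<Sum>b\<in>F. exp (W b \<omega>)) / N"
    proof (rule divide_right_mono)
      have "exp (g (Z \<omega>)) \<le> exp (W (Z \<omega>) \<omega>)"
        using le[OF \<omega>] by simp
      also have "\<dots> \<le> (\<Sum>b\<in>F. exp (W b \<omega>))"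
        using \<open>finite F\<close> ZF[OF \<omega>] by (intro member_le_sum) auto
      finally show "exp (g (Z \<omega>)) \<le> (\<Sum>b\<in>F. exp (W b \<omega>))" .
    qed (use \<open>N > 0\<close> in simp)
    finally show "g (Z \<omega>) \<le> (\<Sum>b\<in>F. exp (W b \<omega>)) / N - 1 + ln N"
      by simp
  qed
  also have "\<dots> = ln N"
    using int one \<open>N > 0\<close> by (simp add: prob_space N_def)
  finally show ?thesis
    by (simp add: N_def)
qed

end

section \<open>Risk of the least-squares estimator\<close>

lemma frobenius_norm_power2:
  "(frobenius_norm n A)\<^sup>2 = (\<Sum>(i, j)\<in>{1..n} \<times> {1..n}. (A i j)\<^sup>2)"
  by (simp add: frobenius_norm_def sum_nonneg flip: sum.cartesian_product)

lemma ln_fact_le: "ln (fact n :: real) \<le> real n * ln (real n)"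
proof (cases "n = 0")
  case False
  have "(fact n :: real) \<le> real n ^ n"
    using fact_le_power[where n = n and 'a = real] by simp
  then have "ln (fact n :: real) \<le> ln (real n ^ n)"
    using False by simp
  then show ?thesis
    using False by (simp add: ln_realpow)
qed simp

context least_squares_model
begin

lemma least_squares_risk:
  "1 / (real n)\<^sup>2 * expectation (\<lambda>\<omega>.
      (frobenius_norm n (\<lambda>i j. signal \<rho> lam (\<pi>h \<omega>) i j - signal \<rho> lam \<pi>s i j))\<^sup>2)
    \<le> 8 * ln (real n) / real n"
proof -
  define I where "I = {1..n} \<times> {1..n}"
  define P where "P = {\<pi>. \<pi> permutes {1..n}}"
  define D where "D = (\<lambda>\<pi> (i, j). signal \<rho> lam \<pi> i j - signal \<rho> lam \<pi>s i j)"
  define G where "G = (\<lambda>(i, j) \<omega>. E \<omega> i j)"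
  \<comment> \<open>With coefficients \<open>t * D \<pi> p\<close> in place of
    \<open>D \<pi> p / 2\<close>, optimality of the fit bounds the exponent below by
    \<open>(t - t^2) / 2\<close> times the squared error for \<open>t > 0\<close>;
    \<open>t = 1/2\<close> maximises this and produces the constant 8.\<close>
  define W where "W = (\<lambda>\<pi> \<omega>. \<Sum>p\<in>I. D \<pi> p / 2 * G p \<omega> - (D \<pi> p / 2)\<^sup>2 / 2)"
  have "finite I" "finite P"
    by (auto simp: I_def P_def finite_permutations)
  have frob: "(frobenius_norm n (\<lambda>i j. signal \<rho> lam \<pi> i j - signal \<rho> lam \<pi>s i j))\<^sup>2
      = (\<Sum>p\<in>I. (D \<pi> p)\<^sup>2)" for \<pi>
    unfolding frobenius_norm_power2 I_def D_def by (intro sum.cong) auto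
  note noise = noise_indep[folded G_def I_def]
  have normal: "distributed M lborel (G p) std_normal_density" if "p \<in> I" for p
    using that noise_std_normal by (auto simp: G_def I_def)
  note moment = indep_std_normal_exponential_moment[OF \<open>finite I\<close> noise normal]
  have opt: "(\<Sum>p\<in>I. (D (\<pi>h \<omega>) p)\<^sup>2) / 8 \<le> W (\<pi>h \<omega>) \<omega>" if \<omega>: "\<omega> \<in> space M" for \<omega>
  proof -
    have "(frobenius_norm n (\<lambda>i j. Y \<omega> i j - signal \<rho> lam (\<pi>h \<omega>) i j))\<^sup>2
        \<le> (frobenius_norm n (\<lambda>i j. Y \<omega> i j - signal \<rho> lam \<pi>s i j))\<^sup>2"
      using estimator_arg_min[OF \<omega>] truth_permutes unfolding is_arg_min_linorder by blast
    also have "(frobenius_norm n (\<lambda>i j. Y \<omega> i j - signal \<rho> lam (\<pi>h \<omega>) i j))\<^sup>2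
        = (\<Sum>p\<in>I. (G p \<omega> - D (\<pi>h \<omega>) p)\<^sup>2)"
      unfolding frobenius_norm_power2 I_def
      by (intro sum.cong) (auto simp: D_def G_def observation[OF \<omega>] algebra_simps)
    also have "(frobenius_norm n (\<lambda>i j. Y \<omega> i j - signal \<rho> lam \<pi>s i j))\<^sup>2
        = (\<Sum>p\<in>I. (G p \<omega>)\<^sup>2)"
      unfolding frobenius_norm_power2 I_def
      by (intro sum.cong) (auto simp: G_def observation[OF \<omega>])
    finally have "0 \<le> (\<Sum>p\<in>I. (G p \<omega>)\<^sup>2 - (G p \<omega> - D (\<pi>h \<omega>) p)\<^sup>2)"
      by (simp add: sum_subtractf)
    \<comment> \<open>Each summand is \<open>2 * D * G - D^2\<close>; the split isolates four times
      the summand of \<open>W\<close>.\<close>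
    also have "\<dots> = (\<Sum>p\<in>I. 4 * (D (\<pi>h \<omega>) p / 2 * G p \<omega> - (D (\<pi>h \<omega>) p / 2)\<^sup>2 / 2)
        - (D (\<pi>h \<omega>) p)\<^sup>2 / 2)"
      by (intro sum.cong) (auto simp: field_simps power2_eq_square)
    also have "\<dots> = 4 * W (\<pi>h \<omega>) \<omega> - (\<Sum>p\<in>I. (D (\<pi>h \<omega>) p)\<^sup>2) / 2"
      by (simp add: sum_subtractf W_def right_diff_distrib mult.commute flip: sum_distrib_left sum_divide_distrib)
    finally show ?thesis
      by simp
  qed
  have "expectation (\<lambda>\<omega>. (\<Sum>p\<in>I. (D (\<pi>h \<omega>) p)\<^sup>2) / 8) \<le> ln (card P)"
  proof (rule expectation_selection_le_ln_card[where W = W])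
    show "P \<noteq> {}"
      using truth_permutes by (auto simp: P_def)
    show "\<pi>h \<in> M \<rightarrow>\<^sub>M count_space P"
      unfolding P_def by (rule estimator_measurable)
    show "integrable M (\<lambda>\<omega>. exp (W \<pi> \<omega>))" "expectation (\<lambda>\<omega>. exp (W \<pi> \<omega>)) = 1" for \<pi>
      unfolding W_def by (rule moment; assumption)+
  qed (use \<open>finite P\<close> opt in auto)
  also have "card P = fact n"
    unfolding P_def by (rule card_permutations) auto
  also have "ln (real (fact n)) \<le> real n * ln (real n)"
    using ln_fact_le[of n] by simp
  finally have "expectation (\<lambda>\<omega>. \<Sum>p\<in>I. (D (\<pi>h \<omega>) p)\<^sup>2) \<le> 8 * (real n * ln (real n))"
    by simp
  then have "1 / (real n)\<^sup>2 * expectation (\<lambda>\<omega>. \<Sum>p\<in>I. (D (\<pi>h \<omega>) p)\<^sup>2)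
      \<le> 1 / (real n)\<^sup>2 * (8 * (real n * ln (real n)))"
    by (rule mult_left_mono) simp
  also have "\<dots> = 8 * ln (real n) / real n"
    using n_pos by (simp add: power2_eq_square)
  finally show ?thesis
    by (simp only: frob)
qed

end

section \<open>Constancy of the best constant estimator off the diagonal\<close>

text \<open>One transposition sends \<open>i\<close> to \<open>i'\<close>; a second one moves the
  image of \<open>j\<close> to \<open>j'\<close> and fixes \<open>i'\<close>, because both pairs are
  distinct.\<close>

lemma exists_permutes_pair:
  assumes "i \<in> S" "j \<in> S" "i' \<in> S" "j' \<in> S" "i \<noteq> j" "i' \<noteq> j'"
  obtains \<sigma> where "\<sigma> permutes S" "\<sigma> i = i'" "\<sigma> j = j'"
proof
  let ?\<tau> = "Transposition.transpose i i'"
  let ?\<sigma> = "Transposition.transpose (?\<tau> j) j' \<circ> ?\<tau>"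
  have "?\<tau> j \<in> S"
    using assms by (auto simp: Transposition.transpose_def)
  then show "?\<sigma> permutes S"
    using assms by (intro permutes_compose permutes_swap_id) auto
  have "?\<tau> j \<noteq> i'"
    using assms by (auto simp: Transposition.transpose_def)
  then show "?\<sigma> i = i'"
    using assms by (simp add: Transposition.transpose_def)
  show "?\<sigma> j = j'"
    by simp
qed

text \<open>The uniform average over permutations is invariant under right composition with a
  permutation that carries \<open>(i, j)\<close> to \<open>(i', j')\<close>.\<close>

lemma best_constant_off_diagonal:
  assumes "i \<in> {1..n}" "j \<in> {1..n}" "i' \<in> {1..n}" "j' \<in> {1..n}" "i \<noteq> j" "i' \<noteq> j'"
  shows "best_constant n \<rho> lam i j = best_constant n \<rho> lam i' j'"
proof -
  obtain \<sigma> where \<sigma>: "\<sigma> permutes {1..n}" "\<sigma> i = i'" "\<sigma> j = j'"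
    using exists_permutes_pair[of i "{1..n}" j i' j'] assms by blast
  let ?P = "{\<pi>. \<pi> permutes {1..n}}"
  have "(\<Sum>\<pi>\<in>?P. signal \<rho> lam \<pi> i j) = (\<Sum>\<pi>\<in>?P. signal \<rho> lam (\<pi> \<circ> \<sigma>) i j)"
    by (rule sum_permutations_compose_right[OF \<sigma>(1)])
  moreover have "signal \<rho> lam (\<pi> \<circ> \<sigma>) i j = signal \<rho> lam \<pi> i' j'" for \<pi>
    by (simp add: signal_def \<sigma>)
  moreover have "?P \<noteq> {}" "finite ?P"
    using \<sigma>(1) finite_permutations[of "{1..n}"] by auto
  ultimately show ?thesis
    by (simp add: best_constant_def integral_pmf_of_set)
qed

section \<open>Counting the entries inside and outside the band\<close>

text \<open>Either the \<open>\<rho>\<close> indices after \<open>i\<close> fit into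
  \<open>{1..n}\<close>, or \<open>i\<close> is one of the last \<open>\<rho> + 1\<close> indices,
  and the other \<open>\<rho>\<close> of these are within distance \<open>\<rho>\<close>.\<close>

lemma band_row_card:
  assumes "i \<in> {1..n}" "\<rho> < n"
  shows "\<rho> \<le> card {j \<in> {1..n}. i \<noteq> j \<and> \<bar>int i - int j\<bar> \<le> int \<rho>}"
    (is "_ \<le> card ?R")
proof (cases "i + \<rho> \<le> n")
  case True
  then have "{i<..i + \<rho>} \<subseteq> ?R"
    by auto
  then have "card {i<..i + \<rho>} \<le> card ?R"
    by (intro card_mono) auto
  then show ?thesis
    by simp
next
  case False
  then have "{n - \<rho>..n} - {i} \<subseteq> ?R"
    using assms by auto
  then have "card ({n - \<rho>..n} - {i}) \<le> card ?R"
    by (intro card_mono) auto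
  moreover have "card ({n - \<rho>..n} - {i}) = \<rho>"
    using False assms by (subst card_Diff_singleton) auto
  ultimately show ?thesis
    by simp
qed

lemma band_card:
  assumes "\<rho> < n"
  shows "n * \<rho> \<le> card {(i, j) \<in> {1..n} \<times> {1..n}. i \<noteq> j \<and> \<bar>int i - int j\<bar> \<le> int \<rho>}"
    (is "_ \<le> card ?A")
proof -
  let ?R = "\<lambda>i. {j \<in> {1..n}. i \<noteq> j \<and> \<bar>int i - int j\<bar> \<le> int \<rho>}"
  have "n * \<rho> = (\<Sum>i\<in>{1..n}. \<rho>)"
    by simp
  also have "\<dots> \<le> (\<Sum>i\<in>{1..n}. card (?R i))"
    using assms by (intro sum_mono band_row_card)
  also have "\<dots> = card (SIGMA i:{1..n}. ?R i)"
    by simp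
  also have "(SIGMA i:{1..n}. ?R i) = ?A"
    by auto
  finally show ?thesis .
qed

text \<open>A corner rectangle whose column indices exceed its row indices by more than
  \<open>\<rho>\<close> lies outside the band; its sides are about half of
  \<open>n - \<rho>\<close>.\<close>

lemma off_band_card:
  assumes "\<rho> + 2 \<le> n"
  shows "(real n - real \<rho>)\<^sup>2
    \<le> 8 * real (card {(i, j) \<in> {1..n} \<times> {1..n}. \<not> \<bar>int i - int j\<bar> \<le> int \<rho>})"
    (is "_ \<le> 8 * real (card ?B)")
proof -
  define m where "m = n - \<rho>"
  define p where "p = m div 2"
  have "{1..p} \<times> {p + \<rho> <.. n} \<subseteq> ?B"
    using assms by (auto simp: p_def m_def)
  moreover have "finite ?B"
    by (rule finite_subset[of _ "{1..n} \<times> {1..n}"]) auto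
  ultimately have "card ({1..p} \<times> {p + \<rho> <.. n}) \<le> card ?B"
    by (intro card_mono)
  then have card: "p * (m - p) \<le> card ?B"
    by (simp add: m_def add.commute)
  \<comment> \<open>The first bound absorbs the rounding in \<open>m div 2\<close> and relies on
    \<open>m \<ge> 2\<close>; the two factors multiply to 8.\<close>
  have "real m \<le> 4 * real p" "real m \<le> 2 * real (m - p)"
    using assms by (auto simp: m_def p_def)
  then have "real m * real m \<le> (4 * real p) * (2 * real (m - p))"
    by (intro mult_mono) auto
  also have "\<dots> = 8 * real (p * (m - p))"
    by simp
  also have "\<dots> \<le> 8 * real (card ?B)"
    using card by (simp only: of_nat_le_iff mult_le_cancel_left_pos zero_less_numeral)
  finally show ?thesis
    using assms by (simp add: m_def power2_eq_square)
qed

text \<open>\<open>map_prod \<pi> \<pi>\<close> is a bijection of \<open>S \<times> S\<close>, so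
  counts for any signal reduce to those for the identity permutation.\<close>

lemma card_permuted_pairs:
  assumes "\<pi> permutes S"
  shows "card {(i, j) \<in> S \<times> S. Q (\<pi> i) (\<pi> j)} = card {(i, j) \<in> S \<times> S. Q i j}"
    (is "card ?A = card ?B")
proof -
  have img: "\<pi> i \<in> S \<longleftrightarrow> i \<in> S" for i
    by (rule permutes_in_image[OF assms])
  have "inj (map_prod \<pi> \<pi>)"
    using permutes_inj[OF assms] by (intro prod.inj_map)
  then have "card (map_prod \<pi> \<pi> ` ?A) = card ?A"
    by (rule card_image[OF inj_on_subset]) simp
  moreover have "map_prod \<pi> \<pi> ` ?A = ?B"
  proof (intro equalityI subsetI)
    fix p assume "p \<in> ?B"
    then obtain i j where "p = (i, j)" "i \<in> S" "j \<in> S" "Q i j"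
      by blast
    moreover obtain i' j' where "i = \<pi> i'" "j = \<pi> j'"
      using permutes_surj[OF assms] by (meson surjE)
    ultimately show "p \<in> map_prod \<pi> \<pi> ` ?A"
      by (intro image_eqI[of _ _ "(i', j')"]) (auto simp: img)
  qed (auto simp: img)
  ultimately show ?thesis
    by simp
qed

section \<open>Lower bound on the risk of the best constant estimator\<close>

text \<open>The gap between the two sides is a square, which vanishes when \<open>c\<close> is the
  weighted mean \<open>a * x / (a + b)\<close>. Clearing the denominator also covers
  \<open>a + b = 0\<close>.\<close>

lemma two_value_variance:
  fixes a b x c :: real
  assumes "0 \<le> a" "0 \<le> b"
  shows "x\<^sup>2 * (a * b) \<le> (a * (x - c)\<^sup>2 + b * c\<^sup>2) * (a + b)"
proof -
  have "(a * (x - c)\<^sup>2 + b * c\<^sup>2) * (a + b) = x\<^sup>2 * (a * b) + (a * (x - c) - b * c)\<^sup>2"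
    by (simp add: power2_eq_square algebra_simps)
  then show ?thesis
    by simp
qed

text \<open>The two-value bound is combined with the two counts and with
  \<open>a + b \<le> n^2\<close>, after which one factor \<open>n\<close> cancels.\<close>

lemma best_constant_risk:
  assumes "\<pi> permutes {1..n}" "\<rho> + 2 \<le> n"
  shows "lam\<^sup>2 * real \<rho> * (real n - real \<rho>)\<^sup>2
    \<le> 8 * real n *
        (frobenius_norm n (\<lambda>i j. signal \<rho> lam \<pi> i j - best_constant n \<rho> lam i j))\<^sup>2"
proof -
  define R where "R = (frobenius_norm n (\<lambda>i j. signal \<rho> lam \<pi> i j - best_constant n \<rho> lam i j))\<^sup>2"
  \<comment> \<open>The condition \<open>\<pi> i \<noteq> \<pi> j\<close> removes the diagonal,
    where the constant \<open>c\<close> need not be the value of the estimator; \<open>B\<close>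
    avoids the diagonal by itself.\<close>
  define A where
    "A = {(i, j) \<in> {1..n} \<times> {1..n}. \<pi> i \<noteq> \<pi> j \<and> \<bar>int (\<pi> i) - int (\<pi> j)\<bar> \<le> int \<rho>}"
  define B where "B = {(i, j) \<in> {1..n} \<times> {1..n}. \<not> \<bar>int (\<pi> i) - int (\<pi> j)\<bar> \<le> int \<rho>}"
  define a where "a = real (card A)"
  define b where "b = real (card B)"
  define c where "c = best_constant n \<rho> lam 1 2"
  have const: "best_constant n \<rho> lam i j = c" if "i \<in> {1..n}" "j \<in> {1..n}" "i \<noteq> j" for i j
    unfolding c_def using that assms(2) by (intro best_constant_off_diagonal) auto
  have sub: "A \<subseteq> {1..n} \<times> {1..n}" "B \<subseteq> {1..n} \<times> {1..n}" and disj: "A \<inter> B = {}"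
    by (auto simp: A_def B_def)
  have fin: "finite A" "finite B"
    by (simp_all add: finite_subset[OF sub(1)] finite_subset[OF sub(2)])
  have "card A = card {(i, j) \<in> {1..n} \<times> {1..n}. i \<noteq> j \<and> \<bar>int i - int j\<bar> \<le> int \<rho>}"
    unfolding A_def
    by (rule card_permuted_pairs[OF assms(1), where Q = "\<lambda>i j. i \<noteq> j \<and> \<bar>int i - int j\<bar> \<le> int \<rho>"])
  with band_card[of \<rho> n] assms(2) have "n * \<rho> \<le> card A"
    by simp
  then have a: "real n * real \<rho> \<le> a"
    unfolding a_def by (metis of_nat_le_iff of_nat_mult)
  have "card B = card {(i, j) \<in> {1..n} \<times> {1..n}. \<not> \<bar>int i - int j\<bar> \<le> int \<rho>}"
    unfolding B_def
    by (rule card_permuted_pairs[OF assms(1), where Q = "\<lambda>i j. \<not> \<bar>int i - int j\<bar> \<le> int \<rho>"])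
  with off_band_card[OF assms(2)] have b: "(real n - real \<rho>)\<^sup>2 \<le> 8 * b"
    by (simp add: b_def)
  have "card (A \<union> B) \<le> card ({1..n} \<times> {1..n})"
    using sub by (intro card_mono) auto
  then have "card A + card B \<le> n * n"
    using fin disj by (simp add: card_Un_disjoint)
  then have ab: "a + b \<le> (real n)\<^sup>2"
    unfolding a_def b_def power2_eq_square by (metis of_nat_add of_nat_le_iff of_nat_mult)
  let ?f = "\<lambda>(i, j). (signal \<rho> lam \<pi> i j - best_constant n \<rho> lam i j)\<^sup>2"
  have "a * (lam - c)\<^sup>2 + b * c\<^sup>2 = sum ?f A + sum ?f B"
  proof -
    have "?f p = (lam - c)\<^sup>2" if p: "p \<in> A" for p
    proof -
      obtain i j where "p = (i, j)" "i \<in> {1..n}" "j \<in> {1..n}" "\<pi> i \<noteq> \<pi> j"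
        "\<bar>int (\<pi> i) - int (\<pi> j)\<bar> \<le> int \<rho>"
        using p unfolding A_def by blast
      moreover from this have "i \<noteq> j"
        by auto
      ultimately show ?thesis
        using const[of i j] by (simp add: signal_def)
    qed
    moreover have "?f p = c\<^sup>2" if p: "p \<in> B" for p
    proof -
      obtain i j where "p = (i, j)" "i \<in> {1..n}" "j \<in> {1..n}"
        "\<not> \<bar>int (\<pi> i) - int (\<pi> j)\<bar> \<le> int \<rho>"
        using p unfolding B_def by blast
      moreover from this have "i \<noteq> j"
        by auto
      ultimately show ?thesis
        using const[of i j] by (simp add: signal_def)
    qed
    ultimately show ?thesis
      by (simp add: a_def b_def)
  qed
  also have "\<dots> = sum ?f (A \<union> B)"
    using fin disj by (simp add: sum.union_disjoint)
  \<comment> \<open>Only the nonnegative diagonal terms are dropped.\<close>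
  also have "\<dots> \<le> R"
    unfolding R_def frobenius_norm_power2 using sub by (intro sum_mono2) auto
  finally have "(a * (lam - c)\<^sup>2 + b * c\<^sup>2) * (a + b) \<le> R * (real n)\<^sup>2"
    using ab by (intro mult_mono) (auto simp: a_def b_def R_def)
  then have "lam\<^sup>2 * (a * b) \<le> R * (real n)\<^sup>2"
    using two_value_variance[of a b lam c] by (simp add: a_def b_def)
  moreover have "lam\<^sup>2 * ((real n * real \<rho>) * (real n - real \<rho>)\<^sup>2) \<le> lam\<^sup>2 * (a * (8 * b))"
    using a b by (intro mult_left_mono mult_mono) (auto simp: a_def)
  ultimately have "real n * (lam\<^sup>2 * real \<rho> * (real n - real \<rho>)\<^sup>2) \<le> real n * (8 * real n * R)"
    by (simp add: power2_eq_square mult_ac)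
  then show ?thesis
    using assms(2) unfolding R_def by (subst (asm) mult_le_cancel_left_pos) auto
qed

section \<open>Weak reconstruction\<close>

text \<open>Two positions in \<open>{1..n}\<close> differ by at most \<open>n - 1\<close>. In this
  degenerate case the estimation error vanishes.\<close>

lemma signal_bandwidth_full:
  assumes "\<pi> permutes {1..n}" "n \<le> \<rho> + 1" "i \<in> {1..n}" "j \<in> {1..n}"
  shows "signal \<rho> lam \<pi> i j = lam"
  using permutes_in_image[OF assms(1), of i] permutes_in_image[OF assms(1), of j] assms(2-)
  by (auto simp: signal_def)

text \<open>Comparing the two risk bounds, it suffices that
  \<open>64 * ln n \<le> \<epsilon> * \<delta>^2 * lam^2 * \<rho>\<close>, where 64 is the product
  of the factors 8 from either bound. The hypothesis on \<open>lam\<close> bounds the right-hand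
  side below by \<open>128 * (ln n)^2\<close>.\<close>

lemma (in least_squares_model) weak_reconstruction:
  assumes "0 < \<epsilon>" "0 < \<delta>" "1 \<le> \<rho>" "real \<rho> \<le> (1 - \<delta>) * real n"
    and lam: "sqrt (128 / (\<epsilon> * \<delta>\<^sup>2)) * (ln (real n) / sqrt (real \<rho>)) \<le> lam"
  shows "1 / (real n)\<^sup>2 * expectation (\<lambda>\<omega>.
      (frobenius_norm n (\<lambda>i j. signal \<rho> lam (\<pi>h \<omega>) i j - signal \<rho> lam \<pi>s i j))\<^sup>2)
    \<le> \<epsilon> * (1 / (real n)\<^sup>2 *
        (frobenius_norm n (\<lambda>i j. signal \<rho> lam \<pi>s i j - best_constant n \<rho> lam i j))\<^sup>2)"
    (is "_ * expectation ?L \<le> \<epsilon> * (_ * ?R)")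
proof (cases "\<rho> + 2 \<le> n")
  case False
  have "?L \<omega> = 0" if "\<omega> \<in> space M" for \<omega>
  proof -
    have "\<pi>h \<omega> permutes {1..n}"
      using measurable_space[OF estimator_measurable that] by simp
    then show ?thesis
      unfolding frobenius_norm_power2 using truth_permutes False
      by (intro sum.neutral) (auto simp: signal_bandwidth_full)
  qed
  then have "expectation ?L = expectation (\<lambda>_. 0)"
    by (intro Bochner_Integration.integral_cong) auto
  then show ?thesis
    using \<open>0 < \<epsilon>\<close> by simp
next
  case True
  let ?l = "ln (real n)"
  have "1 / 2 \<le> ln (2::real)"
    using ln2_ge_two_thirds by simp
  also have "\<dots> \<le> ?l"
    using True by simp
  finally have l: "1 \<le> 2 * ?l"
    by simp
  have "(sqrt (128 / (\<epsilon> * \<delta>\<^sup>2)) * (?l / sqrt (real \<rho>)))\<^sup>2 \<le> lam\<^sup>2"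
    using lam l assms(1) by (intro power_mono) auto
  then have "128 / (\<epsilon> * \<delta>\<^sup>2) * (?l\<^sup>2 / real \<rho>) \<le> lam\<^sup>2"
    using assms(1) by (simp add: power_mult_distrib power_divide)
  then have "128 * ?l\<^sup>2 \<le> \<epsilon> * \<delta>\<^sup>2 * lam\<^sup>2 * real \<rho>"
    using assms(1-3) by (simp add: field_simps)
  \<comment> \<open>\<open>n \<ge> 2\<close> gives \<open>1 \<le> 2 * ?l\<close>, which trades the
    linear logarithm for the squared one and doubles 64 to 128.\<close>
  moreover have "64 * ?l \<le> 128 * ?l\<^sup>2"
    using l mult_left_mono[OF l, of "64 * ?l"] by (simp add: power2_eq_square)
  ultimately have "64 * ?l * (real n)\<^sup>2 \<le> \<epsilon> * \<delta>\<^sup>2 * lam\<^sup>2 * real \<rho> * (real n)\<^sup>2"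
    by (intro mult_right_mono) auto
  also have "\<dots> = \<epsilon> * (lam\<^sup>2 * real \<rho> * (\<delta> * real n)\<^sup>2)"
    by (simp add: power_mult_distrib)
  also have "\<dots> \<le> \<epsilon> * (lam\<^sup>2 * real \<rho> * (real n - real \<rho>)\<^sup>2)"
    using assms(1,2,4) by (intro mult_left_mono power_mono) (auto simp: algebra_simps)
  also have "\<dots> \<le> \<epsilon> * (8 * real n * ?R)"
    using best_constant_risk[OF truth_permutes True] assms(1) by (intro mult_left_mono) auto
  finally have "8 * ?l / real n \<le> \<epsilon> * (1 / (real n)\<^sup>2 * ?R)"
    using True by (simp add: field_simps power2_eq_square)
  then show ?thesis
    using least_squares_risk by linarith
qed

text \<open>"Small" and "large compared to" are rendered by \<open>\<epsilon>\<close> and a constant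
  \<open>C\<close> that depends on \<open>\<epsilon>\<close> and \<open>\<delta>\<close> only. The
  parameter \<open>\<delta>\<close> keeps \<open>n - \<rho>\<close>, which enters the baseline risk
  bound squared, proportional to \<open>n\<close>. For \<open>\<rho> = 0\<close> the quotient by
  \<open>sqrt \<rho>\<close> would be 0 by convention; \<open>1 \<le> \<rho>\<close> rules this
  out.\<close>

theorem proposition4p3:
  shows
    "(\<forall>(M :: 'a measure) n \<rho> lam \<pi>s E Y \<pi>h.
        least_squares_model M n \<rho> lam \<pi>s E Y \<pi>h \<longrightarrow>
        1 / (real n)\<^sup>2 * prob_space.expectation M (\<lambda>\<omega>.
            (frobenius_norm n (\<lambda>i j. signal \<rho> lam (\<pi>h \<omega>) i j - signal \<rho> lam \<pi>s i j))\<^sup>2)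
          \<le> 8 * ln (real n) / real n)
     \<and>
     (\<forall>\<epsilon> > 0. \<forall>\<delta> > 0. \<exists>C > 0.
        \<forall>(M :: 'a measure) n \<rho> lam \<pi>s E Y \<pi>h.
          least_squares_model M n \<rho> lam \<pi>s E Y \<pi>h \<longrightarrow>
          1 \<le> \<rho> \<longrightarrow> real \<rho> \<le> (1 - \<delta>) * real n \<longrightarrow>
          C * (ln (real n) / sqrt (real \<rho>)) \<le> lam \<longrightarrow>
          1 / (real n)\<^sup>2 * prob_space.expectation M (\<lambda>\<omega>.
              (frobenius_norm n (\<lambda>i j. signal \<rho> lam (\<pi>h \<omega>) i j - signal \<rho> lam \<pi>s i j))\<^sup>2)
            \<le> \<epsilon> * (1 / (real n)\<^sup>2 *
                (frobenius_norm n (\<lambda>i j. signal \<rho> lam \<pi>s i j - best_constant n \<rho> lam i j))\<^sup>2))"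
proof (intro conjI allI impI)
  fix \<epsilon> \<delta> :: real
  assume "0 < \<epsilon>" "0 < \<delta>"
  then show "\<exists>C > 0.
      \<forall>(M :: 'a measure) n \<rho> lam \<pi>s E Y \<pi>h.
        least_squares_model M n \<rho> lam \<pi>s E Y \<pi>h \<longrightarrow>
        1 \<le> \<rho> \<longrightarrow> real \<rho> \<le> (1 - \<delta>) * real n \<longrightarrow>
        C * (ln (real n) / sqrt (real \<rho>)) \<le> lam \<longrightarrow>
        1 / (real n)\<^sup>2 * prob_space.expectation M (\<lambda>\<omega>.
            (frobenius_norm n (\<lambda>i j. signal \<rho> lam (\<pi>h \<omega>) i j - signal \<rho> lam \<pi>s i j))\<^sup>2)
          \<le> \<epsilon> * (1 / (real n)\<^sup>2 *
              (frobenius_norm n (\<lambda>i j. signal \<rho> lam \<pi>s i j - best_constant n \<rho> lam i j))\<^sup>2)"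
    by (intro exI[of _ "sqrt (128 / (\<epsilon> * \<delta>\<^sup>2))"] conjI allI impI)
      (simp, erule (5) least_squares_model.weak_reconstruction)
next
  fix M :: "'a measure" and n \<rho> lam \<pi>s E Y \<pi>h
  assume "least_squares_model M n \<rho> lam \<pi>s E Y \<pi>h"
  then show "1 / (real n)\<^sup>2 * prob_space.expectation M (\<lambda>\<omega>.
      (frobenius_norm n (\<lambda>i j. signal \<rho> lam (\<pi>h \<omega>) i j - signal \<rho> lam \<pi>s i j))\<^sup>2)
    \<le> 8 * ln (real n) / real n"
    by (rule least_squares_model.least_squares_risk)
qed

end
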